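(* Let $g=g_1\cdots g_s\in K[[X]][Y]$ be the decomposition of a square-free monic polynomial $g$ of degree $\geq1$ in $Y$ into its irreducible (monic) factors $g_i\in K[[X]][Y]$, and put $m_i=\deg_Y g_i$. For $i=1,\dots,s$, let $$\mathcal{B}^{(i)}=\left\{1=p_0^{(i)},\frac{p_1^{(i)}}{X^{e_1^{(i)}}},\ldots,\frac{p_{m_i-1}^{(i)}}{X^{e_{m_i-1}^{(i)}}}\right\}$$ represent an integral basis for $g_i$, where $p_d^{(i)}\in K[[X]][Y]$ is monic of degree $d$ in $Y$ and the $e_d^{(i)}$ are integers. Set $h_i=\prod_{j\neq i}g_j$, and let $a_i,b_i\in K[[X]][Y]$ and $c_i\in\mathbb{N}$ be such that $$a_ig_i+b_ih_i=X^{c_i},\qquad i=1,\dots,s.$$ For each $i$, set $$\widetilde{\mathcal{B}}^{(i)}=\left\{\frac{b_ih_i}{X^{c_i}},\frac{b_ih_ip_1^{(i)}}{X^{c_i+e_1^{(i)}}},\ldots,\frac{b_ih_ip_{m_i-1}^{(i)}}{X^{c_i+e_{m_i-1}^{(i)}}}\right\}.$$ Then $\widetilde{\mathcal{B}}^{(1)}\cup\ldots\cup\widetilde{\mathcal{B}}^{(s)}$ represents an integral basis for $g$.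
   Context: $K$ is a field of characteristic zero. For a square-free monic polynomial $g\in K[[X]][Y]$ of degree $m\ge1$ in $Y$, let $B=K[[x]][y]=K[[X]][Y]/\langle g\rangle$, with $x,y$ the residue classes of $X,Y$. The normalization $\overline{B}$ is the integral closure of $B$ in its total ring of fractions $K((X))[Y]/\langle g\rangle$; it is a free $K[[x]]$-module of rank $m$. An integral basis for $g$ is a set of free generators of $\overline{B}$ as a $K[[x]]$-module. A set of elements of $K((X))[Y]$ represents an integral basis for $g$ if their residue classes modulo $g$ form an integral basis for $g$. *)

theory Defs
  imports
    "HOL-Algebra.Algebraic_Closure_Type"
    "HOL-Computational_Algebra.Formal_Laurent_Series"
    "HOL-Computational_Algebra.Squarefree"
begin

section \<open>Integral closure and free generators in a commutative ring\<close>

text \<open>Here \<open>A\<close> is meant to be a subring of the commutative ring \<open>R\<close>. Polynomials over \<open>A\<close>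
  are coefficient lists with the leading coefficient first.\<close>

definition integral_over :: "('a, 'b) ring_scheme \<Rightarrow> 'a set \<Rightarrow> 'a \<Rightarrow> bool"
  where "integral_over R A z \<longleftrightarrow>
    (\<exists>f \<in> carrier (univ_poly R A). f \<noteq> [] \<and> hd f = \<one>\<^bsub>R\<^esub> \<and> ring.eval R f z = \<zero>\<^bsub>R\<^esub>)"

definition integral_closure :: "('a, 'b) ring_scheme \<Rightarrow> 'a set \<Rightarrow> 'a set"
  where "integral_closure R A = {z \<in> carrier R. integral_over R A z}"

definition generators :: "('a, 'b) ring_scheme \<Rightarrow> 'a set \<Rightarrow> 'a set \<Rightarrow> 'a set \<Rightarrow> bool"
  where "generators R A M S \<longleftrightarrow>
    M = {\<Oplus>\<^bsub>R\<^esub>v\<in>F. k v \<otimes>\<^bsub>R\<^esub> v | F k. finite F \<and> F \<subseteq> S \<and> k \<in> F \<rightarrow> A}"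

definition linearly_independent :: "('a, 'b) ring_scheme \<Rightarrow> 'a set \<Rightarrow> 'a set \<Rightarrow> bool"
  where "linearly_independent R A S \<longleftrightarrow>
    (\<forall>F k. finite F \<and> F \<subseteq> S \<and> k \<in> F \<rightarrow> A \<and> (\<Oplus>\<^bsub>R\<^esub>v\<in>F. k v \<otimes>\<^bsub>R\<^esub> v) = \<zero>\<^bsub>R\<^esub>
       \<longrightarrow> (\<forall>v\<in>F. k v = \<zero>\<^bsub>R\<^esub>))"

definition free_generators :: "('a, 'b) ring_scheme \<Rightarrow> 'a set \<Rightarrow> 'a set \<Rightarrow> 'a set \<Rightarrow> bool"
  where "free_generators R A M S \<longleftrightarrow>
    S \<subseteq> M \<and> generators R A M S \<and> linearly_independent R A S"


section \<open>The ring $K[[x]][y]$ and its normalization\<close>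

text \<open>The types \<open>'k fps poly\<close> and \<open>'k fls poly\<close> are $K[[X]][Y]$ and $K((X))[Y]$.\<close>

abbreviation laurent_poly :: "'k::field fps poly \<Rightarrow> 'k fls poly"
  where "laurent_poly \<equiv> map_poly fps_to_fls"

abbreviation laurent_poly_ring :: "'k::field fls poly ring"
  where "laurent_poly_ring \<equiv> ring_of_type_algebra"

abbreviation poly_ideal :: "'k::field fps poly \<Rightarrow> 'k fls poly set"
  where "poly_ideal g \<equiv> PIdl\<^bsub>laurent_poly_ring\<^esub> (laurent_poly g)"

text \<open>For monic \<open>g\<close>, $K((X))[Y]/\langle g\rangle$ is the total ring of fractions of
  $K[[X]][Y]/\langle g\rangle$.\<close>

definition total_ring :: "'k::field fps poly \<Rightarrow> 'k fls poly set ring"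
  where "total_ring g = laurent_poly_ring Quot poly_ideal g"

definition residue_class :: "'k::field fps poly \<Rightarrow> 'k fls poly \<Rightarrow> 'k fls poly set"
  where "residue_class g f = poly_ideal g +>\<^bsub>laurent_poly_ring\<^esub> f"

text \<open>For monic \<open>g\<close>, the rings $K[[X]][Y]/\langle g\rangle$ and (if \<open>g\<close> is not constant)
  $K[[X]]$ embed into $K((X))[Y]/\langle g\rangle$; they are represented by their images.\<close>

definition base_ring :: "'k::field fps poly \<Rightarrow> 'k fls poly set set"
  where "base_ring g = range (\<lambda>r. residue_class g (laurent_poly [:r:]))"

definition coordinate_ring :: "'k::field fps poly \<Rightarrow> 'k fls poly set set"
  where "coordinate_ring g = range (\<lambda>f. residue_class g (laurent_poly f))"

definition normalization :: "'k::field fps poly \<Rightarrow> 'k fls poly set set"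
  where "normalization g = integral_closure (total_ring g) (coordinate_ring g)"

definition integral_basis :: "'k::field fps poly \<Rightarrow> 'k fls poly set set \<Rightarrow> bool"
  where "integral_basis g S \<longleftrightarrow>
    free_generators (total_ring g) (base_ring g) (normalization g) S"

definition represents_integral_basis :: "'k::field fps poly \<Rightarrow> 'k fls poly set \<Rightarrow> bool"
  where "represents_integral_basis g S \<longleftrightarrow> integral_basis g (residue_class g ` S)"

definition div_X_power :: "'k::field fps poly \<Rightarrow> int \<Rightarrow> 'k fls poly"
  where "div_X_power f n = Polynomial.smult (inverse (fls_X powi n)) (laurent_poly f)"


section \<open>Basic facts\<close>

lemma cring_laurent_poly_ring: "cring (laurent_poly_ring :: 'k::field fls poly ring)"
  by (rule cring_from_type_algebra)

lemma laurent_poly_hom: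
  "laurent_poly (f + f') = laurent_poly f + laurent_poly f'"
  "laurent_poly (f * f') = laurent_poly f * laurent_poly f'"
  "laurent_poly (- f) = - laurent_poly f"
  "laurent_poly 1 = 1"
proof -
  show "laurent_poly (f + f') = laurent_poly f + laurent_poly f'"
    by (rule poly_eqI) (simp add: coeff_map_poly fps_to_fls_plus)
  show "laurent_poly (- f) = - laurent_poly f"
    by (rule poly_eqI) (simp add: coeff_map_poly fps_to_fls_uminus)
  have sum: "fps_to_fls (\<Sum>i\<in>I. u i) = (\<Sum>i\<in>I. fps_to_fls (u i))"
    for u :: "nat \<Rightarrow> 'a fps" and I
    by (induction I rule: infinite_finite_induct) (auto simp: fps_to_fls_plus)
  show "laurent_poly (f * f') = laurent_poly f * laurent_poly f'"
    by (rule poly_eqI) (simp add: coeff_map_poly coeff_mult sum fls_times_fps_to_fls)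
  show "laurent_poly 1 = 1"
    by (simp add: map_poly_1')
qed

lemma ideal_poly_ideal: "ideal (poly_ideal g) laurent_poly_ring"
  by (intro cring.cgenideal_ideal cring_laurent_poly_ring) (simp add: ring_of_type_algebra_def)

lemma cring_total_ring: "cring (total_ring g)"
  unfolding total_ring_def
  by (intro ideal.quotient_is_cring ideal_poly_ideal cring_laurent_poly_ring)

lemma residue_class_hom: "residue_class g \<in> ring_hom laurent_poly_ring (total_ring g)"
  unfolding total_ring_def residue_class_def
  using ideal.rcos_ring_hom[OF ideal_poly_ideal] .

lemma subring_coordinate_ring: "subring (coordinate_ring g) (total_ring g)"
proof -
  have R: "ring laurent_poly_ring" "ring (total_ring g)"
    by (rule cring.axioms(1), rule cring_laurent_poly_ring cring_total_ring)+
  interpret h: ring_hom_ring laurent_poly_ring "total_ring g" "residue_class g"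
    using R residue_class_hom by (intro ring_hom_ringI2)
  have "subring (range laurent_poly) (laurent_poly_ring :: 'a fls poly ring)"
  proof (rule h.R.subringI)
    show "\<one>\<^bsub>laurent_poly_ring\<^esub> \<in> range (laurent_poly :: 'a fps poly \<Rightarrow> _)"
      using laurent_poly_hom(4) by (metis rangeI ring_of_type_algebra_def ring.simps monoid.simps)
  next
    fix u :: "'a fls poly" assume "u \<in> range laurent_poly"
    then obtain f where f: "u = laurent_poly f" by auto
    have "\<ominus>\<^bsub>laurent_poly_ring\<^esub> u = - u"
      by (rule h.R.minus_equality) (auto simp: ring_of_type_algebra_def)
    then show "\<ominus>\<^bsub>laurent_poly_ring\<^esub> u \<in> range laurent_poly"
      using f laurent_poly_hom(3) by (metis rangeI)
  qed (auto simp: ring_of_type_algebra_def laurent_poly_hom(1,2)[symmetric])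
  then have "subring (residue_class g ` range laurent_poly) (total_ring g)"
    by (rule h.img_is_subring)
  then show ?thesis
    by (simp add: coordinate_ring_def image_image)
qed

end

theory Submission
  imports Defs "HOL-Number_Theory.Cong"
begin

text \<open>Write \<open>G\<close> and \<open>G\<^sub>i\<close> for \<open>g\<close> and \<open>g\<^sub>i\<close> as elements of the principal ideal domain
  $K((X))[Y]$. Since $K((X))$ inverts \<open>X\<close>, the relations $a_i g_i + b_i h_i = X^{c_i}$ say that the
  \<open>G\<^sub>i\<close> are pairwise comaximal and that $E_i = b_i h_i / X^{c_i}$ is \<open>1\<close> modulo \<open>G\<^sub>i\<close> and \<open>0\<close> modulo
  the other factors: the \<open>E\<^sub>i\<close> are the idempotents of the Chinese remainder decomposition of
  $K((X))[Y]/\<langle>G\<rangle>$ into the rings $K((X))[Y]/\<langle>G_i\<rangle>$.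

  This decomposition restricts to the normalizations. A polynomial \<open>f\<close> is integral modulo \<open>G\<close> if and
  only if it is integral modulo every \<open>G\<^sub>i\<close>: an integral equation modulo \<open>G\<close> is one modulo each
  factor, and the product of integral equations modulo the factors is one modulo \<open>G\<close>
  (\<open>integral_mod_prod_iff\<close>). A combination of the elements $E_i B_{i,d}$, where the $B_{i,d}$ represent an
  integral basis for \<open>g\<^sub>i\<close>, is modulo \<open>G\<^sub>j\<close> the combination of the $B_{j,d}$ with the same coefficients.
  Hence prescribing the coefficients of such a combination is the same as prescribing a combination
  of $B_{j,d}$ modulo each \<open>G\<^sub>j\<close> independently, so that generation and independence pass from
  the factors to \<open>g\<close> (\<open>represents_integral_basis_prod\<close>).

  For this argument the quotient rings are replaced by congruences between polynomials: for a finite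
  family of polynomials with distinct residue classes, \<open>represents_integral_basis_iff\<close> says what it
  means to represent an integral basis in these terms.\<close>

section \<open>Residue classes as congruences\<close>

lemma residue_class_simps:
  "residue_class g f \<oplus>\<^bsub>total_ring g\<^esub> residue_class g f' = residue_class g (f + f')"
  "residue_class g f \<otimes>\<^bsub>total_ring g\<^esub> residue_class g f' = residue_class g (f * f')"
  "\<one>\<^bsub>total_ring g\<^esub> = residue_class g 1"
  "\<zero>\<^bsub>total_ring g\<^esub> = residue_class g 0"
  "residue_class g f \<in> carrier (total_ring g)"
proof -
  interpret h: ring_hom_ring laurent_poly_ring "total_ring g" "residue_class g"
    using residue_class_hom cring_laurent_poly_ring cring_total_ring
    by (intro ring_hom_ringI2) (auto intro: cring.axioms(1))
  show "residue_class g f \<oplus>\<^bsub>total_ring g\<^esub> residue_class g f' = residue_class g (f + f')"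
    "residue_class g f \<otimes>\<^bsub>total_ring g\<^esub> residue_class g f' = residue_class g (f * f')"
    "\<one>\<^bsub>total_ring g\<^esub> = residue_class g 1"
    "\<zero>\<^bsub>total_ring g\<^esub> = residue_class g 0"
    "residue_class g f \<in> carrier (total_ring g)"
    using h.hom_add[of f f'] h.hom_mult[of f f'] h.hom_one h.hom_zero h.hom_closed[of f]
    by (simp_all add: ring_of_type_algebra_def)
qed

lemma carrier_total_ring: "carrier (total_ring g) = range (residue_class g)"
  by (auto simp: total_ring_def residue_class_def FactRing_def A_RCOSETS_def' ring_of_type_algebra_def)

lemma residue_class_eq_iff:
  "residue_class g f = residue_class g f' \<longleftrightarrow> [f = f'] (mod laurent_poly g)"
proof -
  have coset: "residue_class g f = {q * laurent_poly g + f | q. True}" for f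
    by (auto simp: residue_class_def cgenideal_def a_r_coset_def' ring_of_type_algebra_def)
  show ?thesis
  proof
    assume "residue_class g f = residue_class g f'"
    moreover have "f \<in> residue_class g f"
      unfolding coset by (auto intro!: exI[of _ 0])
    ultimately obtain q where "f = q * laurent_poly g + f'"
      unfolding coset by auto
    then show "[f = f'] (mod laurent_poly g)"
      by (simp add: cong_iff_dvd_diff)
  next
    assume "[f = f'] (mod laurent_poly g)"
    then obtain q where q: "f - f' = laurent_poly g * q"
      unfolding cong_iff_dvd_diff by auto
    have "q' * laurent_poly g + f = (q' + q) * laurent_poly g + f'"
      "q' * laurent_poly g + f' = (q' - q) * laurent_poly g + f" for q'
      using q by (simp_all add: algebra_simps)
    then show "residue_class g f = residue_class g f'"
      unfolding coset by (smt (verit) Collect_cong)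
  qed
qed

section \<open>The normalization\<close>

text \<open>Integrality of the residue class of \<open>f\<close> over $K[[x]][y]$, with an equation whose coefficients
  are lifted to $K[[X]][Y]$. Unlike an equation over the quotient ring, the same \<open>P\<close> can be read
  modulo several polynomials.\<close>

definition integral_mod :: "'k::field fps poly \<Rightarrow> 'k fls poly \<Rightarrow> bool"
  where "integral_mod g f \<longleftrightarrow>
    (\<exists>P. Polynomial.lead_coeff P = 1 \<and> [poly (map_poly laurent_poly P) f = 0] (mod laurent_poly g))"

text \<open>\<open>ring.eval\<close> expects the leading coefficient first, \<open>Poly\<close> the constant one; hence the \<open>rev\<close>.\<close>

lemma eval_residue_classes:
  "ring.eval (total_ring g) (map (\<lambda>u. residue_class g (laurent_poly u)) (rev us)) (residue_class g f)
    = residue_class g (poly (map_poly laurent_poly (Poly us)) f)"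
proof (induction us)
  interpret cring "total_ring g" by (rule cring_total_ring)
  case Nil
  show ?case by (simp add: residue_class_simps)
next
  interpret cring "total_ring g" by (rule cring_total_ring)
  case (Cons u us)
  have "eval (map (\<lambda>u. residue_class g (laurent_poly u)) (rev us) @ [residue_class g (laurent_poly u)])
      (residue_class g f) =
    residue_class g (poly (map_poly laurent_poly (Poly us)) f) \<otimes>\<^bsub>total_ring g\<^esub> residue_class g f
      \<oplus>\<^bsub>total_ring g\<^esub> residue_class g (laurent_poly u)"
    unfolding Cons.IH[symmetric]
    by (rule eval_append_aux) (auto simp: residue_class_simps)
  then show ?case
    by (simp add: residue_class_simps map_poly_pCons algebra_simps)
qed

lemma degree_laurent_poly: "Polynomial.degree (laurent_poly f) = Polynomial.degree f"
  by (simp add: degree_map_poly)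

lemma cong_small_degree_eq:
  fixes G :: "'a::field poly"
  assumes "[f = f'] (mod G)" "Polynomial.degree f < Polynomial.degree G"
    "Polynomial.degree f' < Polynomial.degree G"
  shows "f = f'"
proof -
  have "G dvd f - f'" using assms(1) by (simp add: cong_iff_dvd_diff)
  moreover have "Polynomial.degree (f - f') < Polynomial.degree G"
    using assms(2,3) by (rule degree_diff_less)
  ultimately show ?thesis
    by (metis dvd_imp_degree_le eq_iff_diff_eq_0 linorder_not_le)
qed

text \<open>An integral equation over $K[[x]][y]$ is lifted coefficientwise, choosing \<open>1\<close> as the lift of the
  leading coefficient. In the other direction a nonconstant \<open>g\<close> makes the total ring nontrivial,
  so that reducing a monic equation keeps its leading coefficient nonzero.\<close>

lemma residue_class_in_normalization_iff:
  fixes g :: "'k::field fps poly"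
  assumes "Polynomial.lead_coeff g = 1" "Polynomial.degree g \<ge> 1"
  shows "residue_class g f \<in> normalization g \<longleftrightarrow> integral_mod g f"
proof -
  let ?R = "total_ring g" and ?\<psi> = "\<lambda>u. residue_class g (laurent_poly u)"
  interpret cring ?R by (rule cring_total_ring)
  have nontrivial: "\<one>\<^bsub>?R\<^esub> \<noteq> \<zero>\<^bsub>?R\<^esub>"
    using cong_small_degree_eq[of 1 0 "laurent_poly g"] degree_laurent_poly[of g] assms(2)
    by (auto simp: residue_class_simps residue_class_eq_iff)
  have \<psi>1: "?\<psi> 1 = \<one>\<^bsub>?R\<^esub>"
    by (simp add: residue_class_simps laurent_poly_hom)
  have "integral_over ?R (coordinate_ring g) (residue_class g f) \<longleftrightarrow> integral_mod g f"
  proof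
    assume "integral_over ?R (coordinate_ring g) (residue_class g f)"
    then obtain l where l: "set l \<subseteq> coordinate_ring g" "l \<noteq> []" "hd l = \<one>\<^bsub>?R\<^esub>"
      "ring.eval ?R l (residue_class g f) = \<zero>\<^bsub>?R\<^esub>"
      by (auto simp: integral_over_def univ_poly_def polynomial_def)
    have "set (tl l) \<subseteq> coordinate_ring g"
      using l(1,2) by (cases l) simp_all
    then have "\<exists>us. tl l = map ?\<psi> us"
      unfolding ex_map_conv coordinate_ring_def by (intro ballI) (drule subsetD, assumption, elim rangeE, rule exI)
    then obtain us where us: "tl l = map ?\<psi> us" ..
    define P where "P = Poly (rev us @ [1])"
    have "l = map ?\<psi> (rev (rev us @ [1]))"
      using l(2,3) us \<psi>1 by (cases l) auto
    with l(4) have "[poly (map_poly laurent_poly P) f = 0] (mod laurent_poly g)"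
      by (simp only: eval_residue_classes P_def residue_class_simps residue_class_eq_iff)
    moreover have "coeffs P = rev us @ [1]"
      by (simp add: P_def)
    then have "Polynomial.lead_coeff P = 1"
      by (metis last_coeffs_eq_coeff_degree last_snoc coeffs_0_eq_Nil snoc_eq_iff_butlast)
    ultimately show "integral_mod g f"
      by (auto simp: integral_mod_def)
  next
    assume "integral_mod g f"
    then obtain P where P: "Polynomial.lead_coeff P = 1"
      "[poly (map_poly laurent_poly P) f = 0] (mod laurent_poly g)"
      by (auto simp: integral_mod_def)
    define l where "l = map ?\<psi> (rev (coeffs P))"
    have "P \<noteq> 0" using P(1) by auto
    then have "l \<noteq> []" "hd l = \<one>\<^bsub>?R\<^esub>"
      using P(1) \<psi>1 by (simp_all add: l_def hd_map hd_rev last_coeffs_eq_coeff_degree)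
    moreover have "set l \<subseteq> coordinate_ring g"
      by (auto simp: l_def coordinate_ring_def)
    moreover have "ring.eval ?R l (residue_class g f) = \<zero>\<^bsub>?R\<^esub>"
      using P(2) by (simp add: l_def eval_residue_classes residue_class_simps residue_class_eq_iff)
    moreover from calculation have "l \<in> carrier (univ_poly ?R (coordinate_ring g))"
      using nontrivial by (simp only: univ_poly_def polynomial_def partial_object.simps mem_Collect_eq simp_thms)
    ultimately show "integral_over ?R (coordinate_ring g) (residue_class g f)"
      unfolding integral_over_def by blast
  qed
  then show ?thesis
    unfolding normalization_def integral_closure_def mem_Collect_eq
    by (simp only: residue_class_simps(5) simp_thms)
qed

lemma integral_mod_cong:
  assumes "[f = f'] (mod laurent_poly g)"
  shows "integral_mod g f \<longleftrightarrow> integral_mod g f'"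
proof -
  have "[poly P f = poly P f'] (mod laurent_poly g)" for P
  proof (induction P)
    case (pCons a P)
    have "[a + f * poly P f = a + f' * poly P f'] (mod laurent_poly g)"
      by (rule cong_add[OF cong_refl cong_mult[OF assms pCons.IH]])
    then show ?case by simp
  qed simp
  then show ?thesis
    unfolding integral_mod_def by (simp add: cong_def)
qed

section \<open>Integrality and divisibility for a product of moduli\<close>

lemma poly_map_laurent_mult:
  "poly (map_poly laurent_poly (P * Q)) f = poly (map_poly laurent_poly P) f * poly (map_poly laurent_poly Q) f"
proof -
  have add: "map_poly laurent_poly (P + Q) = map_poly laurent_poly P + map_poly laurent_poly Q"
    for P Q :: "'a fps poly poly"
    by (rule poly_eqI) (simp add: coeff_map_poly laurent_poly_hom)
  have smult: "map_poly laurent_poly (Polynomial.smult u P) = Polynomial.smult (laurent_poly u) (map_poly laurent_poly P)"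
    for u and P :: "'a fps poly poly"
    by (rule poly_eqI) (simp add: coeff_map_poly laurent_poly_hom)
  show ?thesis
    by (induction P) (simp_all add: add smult map_poly_pCons algebra_simps)
qed

lemma laurent_poly_prod: "laurent_poly (\<Prod>i\<in>I. u i) = (\<Prod>i\<in>I. laurent_poly (u i))"
  by (induction I rule: infinite_finite_induct) (simp_all only: prod.infinite prod.empty prod.insert laurent_poly_hom not_False_eq_True)

text \<open>An equation modulo the product is one modulo each factor. Conversely, if \<open>u i\<close> divides \<open>P\<^sub>i(f)\<close>
  for every \<open>i\<close>, then the product of the \<open>u i\<close> divides the value at \<open>f\<close> of the product of the \<open>P\<^sub>i\<close>,
  which is again monic.\<close>

lemma integral_mod_prod_iff:
  assumes "finite I"
  shows "integral_mod (\<Prod>i\<in>I. u i) f \<longleftrightarrow> (\<forall>i\<in>I. integral_mod (u i) f)"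
proof
  assume "integral_mod (\<Prod>i\<in>I. u i) f"
  then obtain P where P: "Polynomial.lead_coeff P = 1"
    "[poly (map_poly laurent_poly P) f = 0] (mod laurent_poly (\<Prod>i\<in>I. u i))"
    by (auto simp: integral_mod_def)
  have "laurent_poly (u i) dvd laurent_poly (\<Prod>i\<in>I. u i)" if "i \<in> I" for i
    unfolding laurent_poly_prod by (rule dvd_prodI[OF assms that])
  with P show "\<forall>i\<in>I. integral_mod (u i) f"
    unfolding integral_mod_def by (meson cong_dvd_modulus)
next
  assume "\<forall>i\<in>I. integral_mod (u i) f"
  with assms show "integral_mod (\<Prod>i\<in>I. u i) f"
  proof induction
    case empty
    show ?case by (auto simp: integral_mod_def laurent_poly_hom intro!: exI[of _ 1])
  next
    case (insert i I)
    then obtain P Q where "Polynomial.lead_coeff P = 1" "Polynomial.lead_coeff Q = 1"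
      "laurent_poly (u i) dvd poly (map_poly laurent_poly P) f"
      "laurent_poly (\<Prod>i\<in>I. u i) dvd poly (map_poly laurent_poly Q) f"
      by (auto simp: integral_mod_def cong_0_iff)
    then show ?case
      using insert.hyps
      by (auto simp: integral_mod_def cong_0_iff poly_map_laurent_mult laurent_poly_hom lead_coeff_mult
        intro!: exI[of _ "P * Q"] mult_dvd_mono)
  qed
qed

text \<open>The factors are split off one at a time. If \<open>z = (\<Prod>i\<in>J. G i) * q\<close>, the Bezout relation of a
  further factor \<open>G i\<close> with its complement, multiplied by \<open>q\<close>, shows that \<open>G i\<close> divides \<open>q\<close>, because the
  product over \<open>J\<close> divides that complement.\<close>

lemma prod_dvd_if_complements_comaximal:
  fixes G :: "'i \<Rightarrow> 'a::comm_ring_1"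
  assumes "finite I"
    and "\<And>i. i \<in> I \<Longrightarrow> G i dvd z"
    and comaximal: "\<And>i. i \<in> I \<Longrightarrow> \<exists>u w. u * G i + w * (\<Prod>j\<in>I - {i}. G j) = 1"
  shows "(\<Prod>i\<in>I. G i) dvd z"
proof -
  have "(\<Prod>i\<in>J. G i) dvd z" if "J \<subseteq> I" for J
    using finite_subset[OF that assms(1)] that
  proof (induction J)
    case (insert i J)
    then obtain q where q: "z = prod G J * q" by auto
    have "prod G J dvd (\<Prod>j\<in>I - {i}. G j)"
      using insert assms(1) by (intro prod_dvd_prod_subset) auto
    then obtain r where r: "(\<Prod>j\<in>I - {i}. G j) = prod G J * r" by auto
    obtain u w where "u * G i + w * (\<Prod>j\<in>I - {i}. G j) = 1"
      using comaximal insert.prems by blast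
    then have "q = (u * G i + w * (prod G J * r)) * q" by (simp add: r)
    also have "\<dots> = G i * (u * q) + z * (w * r)" by (simp add: q algebra_simps)
    also have "G i dvd \<dots>" using assms(2) insert.prems by auto
    finally show ?case using insert.hyps by (simp add: q mult_dvd_mono mult.commute)
  qed auto
  then show ?thesis by simp
qed

section \<open>Integral bases in terms of congruences\<close>

definition power_series_combination :: "('i \<Rightarrow> 'k::field fps) \<Rightarrow> ('i \<Rightarrow> 'k fls poly) \<Rightarrow> 'i set \<Rightarrow> 'k fls poly"
  where "power_series_combination k v I = (\<Sum>i\<in>I. Polynomial.smult (fps_to_fls (k i)) (v i))"

lemma power_series_combination_single:
  assumes "finite I" "i \<in> I"
  shows "power_series_combination (\<lambda>j. if j = i then 1 else 0) v I = v i"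
proof -
  have "(\<Sum>j\<in>I. Polynomial.smult (fps_to_fls (if j = i then 1 else 0)) (v j))
    = (\<Sum>j\<in>I. if j = i then v j else 0)"
    by (rule sum.cong) auto
  then show ?thesis
    using assms by (simp add: power_series_combination_def)
qed

lemma finsum_residue_classes:
  fixes g :: "'k::field fps poly" and v :: "'i \<Rightarrow> 'k fls poly"
  assumes "finite J" "inj_on (\<lambda>i. residue_class g (v i)) J"
  shows "(\<Oplus>\<^bsub>total_ring g\<^esub>u\<in>(\<lambda>i. residue_class g (v i)) ` J. residue_class g (laurent_poly [:r u:]) \<otimes>\<^bsub>total_ring g\<^esub> u)
    = residue_class g (power_series_combination (\<lambda>i. r (residue_class g (v i))) v J)"
proof -
  interpret cring "total_ring g" by (rule cring_total_ring)
  let ?w = "\<lambda>i. residue_class g (v i)"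
  have const: "laurent_poly [:x:] = [:fps_to_fls x:]" for x :: "'k fps"
    by (simp add: map_poly_pCons)
  have "(\<Oplus>\<^bsub>total_ring g\<^esub>u\<in>?w ` J. residue_class g (laurent_poly [:r u:]) \<otimes>\<^bsub>total_ring g\<^esub> u)
    = (\<Oplus>\<^bsub>total_ring g\<^esub>i\<in>J. residue_class g (Polynomial.smult (fps_to_fls (r (?w i))) (v i)))"
    using assms(2) by (subst finsum_reindex) (auto simp: residue_class_simps const)
  also have "\<dots> = residue_class g (\<Sum>i\<in>J. Polynomial.smult (fps_to_fls (r (?w i))) (v i))"
    using assms(1) by induction (simp_all add: residue_class_simps Pi_def)
  finally show ?thesis by (simp add: power_series_combination_def)
qed

text \<open>The notion of an integral basis speaks about a set of residue classes and sums over its finite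
  subsets. Distinctness of the classes allows coefficients to be indexed by \<open>I\<close> instead, and every
  sum becomes one over all of \<open>I\<close> by adding zero coefficients. That the generators lie in the
  normalization follows from the first condition on the right, as each of them is a combination.\<close>

lemma represents_integral_basis_iff:
  fixes g :: "'k::field fps poly" and v :: "'i \<Rightarrow> 'k fls poly"
  assumes "Polynomial.lead_coeff g = 1" "Polynomial.degree g \<ge> 1" "finite I"
    and inj: "inj_on (\<lambda>i. residue_class g (v i)) I"
  shows "represents_integral_basis g (v ` I) \<longleftrightarrow>
    (\<forall>f. integral_mod g f \<longleftrightarrow> (\<exists>k. [f = power_series_combination k v I] (mod laurent_poly g))) \<and>
    (\<forall>k. [power_series_combination k v I = 0] (mod laurent_poly g) \<longrightarrow> (\<forall>i\<in>I. k i = 0))"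
    (is "_ \<longleftrightarrow> ?gen \<and> ?indep")
proof -
  let ?R = "total_ring g" and ?A = "base_ring g" and ?M = "normalization g"
  let ?w = "\<lambda>i. residue_class g (v i)" and ?\<kappa> = "\<lambda>r. residue_class g (laurent_poly [:r:])"
  interpret cring ?R by (rule cring_total_ring)
  have M_iff: "residue_class g f \<in> ?M \<longleftrightarrow> integral_mod g f" for f
    by (rule residue_class_in_normalization_iff[OF assms(1,2)])
  have M_carrier: "\<exists>f. x = residue_class g f" if "x \<in> ?M" for x
    using that by (auto simp: normalization_def integral_closure_def carrier_total_ring)
  have \<kappa>_eq_0: "?\<kappa> r = \<zero>\<^bsub>?R\<^esub> \<longleftrightarrow> r = 0" for r
    using cong_small_degree_eq[of "laurent_poly [:r:]" 0 "laurent_poly g"]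
      degree_laurent_poly[of g] assms(2)
    by (auto simp: residue_class_simps residue_class_eq_iff map_poly_pCons)
  \<comment> \<open>The second conjunct, which ties the new coefficients to the given ones, serves independence.\<close>
  have to_comb: "\<exists>k'. (\<Oplus>\<^bsub>?R\<^esub>u\<in>F. k u \<otimes>\<^bsub>?R\<^esub> u) = residue_class g (power_series_combination k' v I) \<and>
      (\<forall>i\<in>I. ?w i \<in> F \<longrightarrow> k (?w i) = ?\<kappa> (k' i))"
    if F: "F \<subseteq> ?w ` I" and k: "k \<in> F \<rightarrow> ?A" for F k
  proof -
    define J where "J = {i \<in> I. ?w i \<in> F}"
    have J: "J \<subseteq> I" "finite J" "F = ?w ` J" "inj_on ?w J"
      using F assms(3) inj_on_subset[OF inj] by (auto simp: J_def)
    have "\<forall>u\<in>F. \<exists>r. k u = ?\<kappa> r"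
      using k by (auto simp: base_ring_def Pi_def)
    then obtain r where r: "\<And>u. u \<in> F \<Longrightarrow> k u = ?\<kappa> (r u)" by metis
    define k' where "k' i = (if i \<in> J then r (?w i) else 0)" for i
    have "(\<Oplus>\<^bsub>?R\<^esub>u\<in>F. k u \<otimes>\<^bsub>?R\<^esub> u) = (\<Oplus>\<^bsub>?R\<^esub>u\<in>F. ?\<kappa> (r u) \<otimes>\<^bsub>?R\<^esub> u)"
      using r J(3) by (intro finsum_cong') (auto simp: residue_class_simps)
    also have "\<dots> = residue_class g (power_series_combination (\<lambda>i. r (?w i)) v J)"
      unfolding J(3) using J by (intro finsum_residue_classes)
    also have "power_series_combination (\<lambda>i. r (?w i)) v J = power_series_combination k' v I"
      unfolding power_series_combination_def k'_def
      by (rule sum.mono_neutral_cong_left) (use J assms(3) in auto)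
    finally have "(\<Oplus>\<^bsub>?R\<^esub>u\<in>F. k u \<otimes>\<^bsub>?R\<^esub> u) = residue_class g (power_series_combination k' v I)" .
    moreover have "\<forall>i\<in>I. ?w i \<in> F \<longrightarrow> k (?w i) = ?\<kappa> (k' i)"
      using r by (auto simp: k'_def J_def)
    ultimately show ?thesis by blast
  qed
  have from_comb: "residue_class g (power_series_combination k' v I) =
      (\<Oplus>\<^bsub>?R\<^esub>u\<in>?w ` I. ?\<kappa> (k' (inv_into I ?w u)) \<otimes>\<^bsub>?R\<^esub> u)" for k'
    unfolding finsum_residue_classes[OF assms(3) inj] power_series_combination_def
    by (intro arg_cong[where f = "residue_class g"] sum.cong refl) (simp add: inv_into_f_f[OF inj])
  let ?span = "{\<Oplus>\<^bsub>?R\<^esub>u\<in>F. k u \<otimes>\<^bsub>?R\<^esub> u | F k. finite F \<and> F \<subseteq> ?w ` I \<and> k \<in> F \<rightarrow> ?A}"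
  have span: "?span = range (\<lambda>k'. residue_class g (power_series_combination k' v I))"
  proof (intro equalityI subsetI)
    fix x assume "x \<in> ?span"
    then obtain F k where "x = (\<Oplus>\<^bsub>?R\<^esub>u\<in>F. k u \<otimes>\<^bsub>?R\<^esub> u)" "F \<subseteq> ?w ` I" "k \<in> F \<rightarrow> ?A"
      by blast
    then show "x \<in> range (\<lambda>k'. residue_class g (power_series_combination k' v I))"
      using to_comb[of F k] by blast
  next
    fix x assume "x \<in> range (\<lambda>k'. residue_class g (power_series_combination k' v I))"
    then obtain k' where k': "x = (\<Oplus>\<^bsub>?R\<^esub>u\<in>?w ` I. ?\<kappa> (k' (inv_into I ?w u)) \<otimes>\<^bsub>?R\<^esub> u)"
      using from_comb by blast
    have "(\<lambda>u. ?\<kappa> (k' (inv_into I ?w u))) \<in> ?w ` I \<rightarrow> ?A"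
      by (simp add: base_ring_def)
    then show "x \<in> ?span"
      using finite_imageI[OF assms(3), of ?w] by - (intro CollectI exI conjI, rule k', auto)
  qed
  have gen: "generators ?R ?A ?M (?w ` I) \<longleftrightarrow> ?gen"
  proof -
    let ?W = "range (\<lambda>k'. residue_class g (power_series_combination k' v I))"
    have "?M = ?W \<longleftrightarrow> (\<forall>f. residue_class g f \<in> ?M \<longleftrightarrow> residue_class g f \<in> ?W)"
    proof
      assume eq: "\<forall>f. residue_class g f \<in> ?M \<longleftrightarrow> residue_class g f \<in> ?W"
      show "?M = ?W"
      proof (intro equalityI subsetI)
        fix x assume x: "x \<in> ?M"
        then obtain f where "x = residue_class g f" using M_carrier by metis
        then show "x \<in> ?W" using x eq by simp
      next
        fix x assume x: "x \<in> ?W"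
        then obtain f where "x = residue_class g f" by (elim rangeE)
        then show "x \<in> ?M" using x eq by simp
      qed
    qed simp
    also have "\<dots> \<longleftrightarrow> ?gen"
      by (simp only: M_iff image_iff bex_UNIV residue_class_eq_iff)
    finally show ?thesis
      unfolding generators_def span .
  qed
  have indep: "linearly_independent ?R ?A (?w ` I) \<longleftrightarrow> ?indep"
  proof
    assume L: "linearly_independent ?R ?A (?w ` I)"
    show ?indep
    proof (intro allI impI ballI)
      fix k i assume "[power_series_combination k v I = 0] (mod laurent_poly g)" and i: "i \<in> I"
      then have "(\<Oplus>\<^bsub>?R\<^esub>u\<in>?w ` I. ?\<kappa> (k (inv_into I ?w u)) \<otimes>\<^bsub>?R\<^esub> u) = \<zero>\<^bsub>?R\<^esub>"
        unfolding from_comb[symmetric] by (simp add: residue_class_simps residue_class_eq_iff)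
      moreover have "(\<lambda>u. ?\<kappa> (k (inv_into I ?w u))) \<in> ?w ` I \<rightarrow> ?A"
        by (simp add: base_ring_def)
      ultimately have "finite (?w ` I) \<and> ?w ` I \<subseteq> ?w ` I \<and>
          (\<lambda>u. ?\<kappa> (k (inv_into I ?w u))) \<in> ?w ` I \<rightarrow> ?A \<and>
          (\<Oplus>\<^bsub>?R\<^esub>u\<in>?w ` I. ?\<kappa> (k (inv_into I ?w u)) \<otimes>\<^bsub>?R\<^esub> u) = \<zero>\<^bsub>?R\<^esub>"
        using assms(3) by (intro conjI finite_imageI order_refl)
      with L have "\<forall>u\<in>?w ` I. ?\<kappa> (k (inv_into I ?w u)) = \<zero>\<^bsub>?R\<^esub>"
        unfolding linearly_independent_def by (elim allE impE)
      then have "\<forall>u\<in>?w ` I. k (inv_into I ?w u) = 0"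
        by (simp only: \<kappa>_eq_0)
      from bspec[OF this imageI[OF i]] show "k i = 0"
        by (simp only: inv_into_f_f[OF inj i])
    qed
  next
    assume ?indep
    show "linearly_independent ?R ?A (?w ` I)"
      unfolding linearly_independent_def
    proof (intro allI impI ballI, elim conjE)
      fix F k u assume F: "F \<subseteq> ?w ` I" and k: "k \<in> F \<rightarrow> ?A" and u: "u \<in> F"
        and zero: "(\<Oplus>\<^bsub>?R\<^esub>u\<in>F. k u \<otimes>\<^bsub>?R\<^esub> u) = \<zero>\<^bsub>?R\<^esub>"
      obtain k' where k': "(\<Oplus>\<^bsub>?R\<^esub>u\<in>F. k u \<otimes>\<^bsub>?R\<^esub> u) = residue_class g (power_series_combination k' v I)"
        "\<forall>i\<in>I. ?w i \<in> F \<longrightarrow> k (?w i) = ?\<kappa> (k' i)"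
        using to_comb[OF F k] by blast
      from trans[OF k'(1)[symmetric] zero]
      have "[power_series_combination k' v I = 0] (mod laurent_poly g)"
        unfolding residue_class_simps residue_class_eq_iff .
      with \<open>?indep\<close> have "\<forall>i\<in>I. k' i = 0" by blast
      moreover obtain i where i: "i \<in> I" "u = ?w i"
        using F u by blast
      moreover have "k u = ?\<kappa> (k' i)"
        using k'(2) i u by metis
      ultimately show "k u = \<zero>\<^bsub>?R\<^esub>"
        by (simp only: \<kappa>_eq_0)
    qed
  qed
  have "?w ` I \<subseteq> ?M" if "generators ?R ?A ?M (?w ` I)"
  proof
    fix x assume "x \<in> ?w ` I"
    then obtain i where i: "i \<in> I" "x = ?w i" by (elim imageE)
    have "x \<in> range (\<lambda>k'. residue_class g (power_series_combination k' v I))"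
      unfolding i(2) by (rule range_eqI[where x = "\<lambda>j. if j = i then 1 else 0"])
        (simp only: power_series_combination_single[OF assms(3) i(1)])
    then show "x \<in> ?M"
      using that unfolding generators_def span by (simp only:)
  qed
  then show ?thesis
    unfolding represents_integral_basis_def integral_basis_def free_generators_def image_image
    using gen indep by blast
qed

section \<open>Glueing integral bases along idempotents\<close>

text \<open>The two conditions on \<open>E i\<close> make it the idempotent belonging to the factor \<open>gs i\<close>; they also imply
  that each factor is comaximal with the product of the others. Modulo \<open>gs j\<close>, a combination of
  the glued family reduces to its part with first index \<open>j\<close>, so both
  conditions of \<open>represents_integral_basis_iff\<close> can be checked modulo each factor.\<close>

lemma represents_integral_basis_prod:
  fixes gs :: "'i \<Rightarrow> 'k::field fps poly" and E :: "'i \<Rightarrow> 'k fls poly"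
    and v :: "'i \<Rightarrow> 'd \<Rightarrow> 'k fls poly"
  assumes "finite I" "I \<noteq> {}"
    and monic: "\<And>i. i \<in> I \<Longrightarrow> Polynomial.lead_coeff (gs i) = 1"
    and degree: "\<And>i. i \<in> I \<Longrightarrow> Polynomial.degree (gs i) \<ge> 1"
    and fin: "\<And>i. i \<in> I \<Longrightarrow> finite (D i)"
    and inj: "\<And>i. i \<in> I \<Longrightarrow> inj_on (\<lambda>d. residue_class (gs i) (v i d)) (D i)"
    and basis: "\<And>i. i \<in> I \<Longrightarrow> represents_integral_basis (gs i) (v i ` D i)"
    and E_one: "\<And>i. i \<in> I \<Longrightarrow> [E i = 1] (mod laurent_poly (gs i))"
    and E_dvd: "\<And>i. i \<in> I \<Longrightarrow> (\<Prod>j\<in>I - {i}. laurent_poly (gs j)) dvd E i"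
  shows "represents_integral_basis (\<Prod>i\<in>I. gs i) ((\<lambda>(i, d). E i * v i d) ` Sigma I D)"
proof -
  define g where "g = (\<Prod>i\<in>I. gs i)"
  define w where "w = (\<lambda>(i, d). E i * v i d)"
  have g_monic: "Polynomial.lead_coeff g = 1"
    unfolding g_def lead_coeff_prod using monic by simp
  obtain i\<^sub>0 where i\<^sub>0: "i\<^sub>0 \<in> I" using assms(2) by auto
  have g_ne: "g \<noteq> 0" using g_monic by auto
  have "gs i\<^sub>0 dvd g"
    unfolding g_def by (rule dvd_prodI[OF assms(1) i\<^sub>0])
  then have g_degree: "Polynomial.degree g \<ge> 1"
    using degree[OF i\<^sub>0] dvd_imp_degree_le[OF _ g_ne] by fastforce
  have cong_g_iff: "[x = y] (mod laurent_poly g) \<longleftrightarrow> (\<forall>i\<in>I. [x = y] (mod laurent_poly (gs i)))" for x y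
  proof
    assume "[x = y] (mod laurent_poly g)"
    then show "\<forall>i\<in>I. [x = y] (mod laurent_poly (gs i))"
      unfolding g_def laurent_poly_prod using dvd_prodI[OF assms(1)] by (metis cong_dvd_modulus)
  next
    assume local: "\<forall>i\<in>I. [x = y] (mod laurent_poly (gs i))"
    have "\<exists>u r. u * laurent_poly (gs i) + r * (\<Prod>j\<in>I - {i}. laurent_poly (gs j)) = 1" if i: "i \<in> I" for i
    proof -
      obtain r where "E i = (\<Prod>j\<in>I - {i}. laurent_poly (gs j)) * r"
        using E_dvd[OF i] by (elim dvdE)
      moreover obtain u where "1 - E i = laurent_poly (gs i) * u"
        using cong_sym[OF E_one[OF i]] unfolding cong_iff_dvd_diff by (elim dvdE)
      ultimately have "u * laurent_poly (gs i) + r * (\<Prod>j\<in>I - {i}. laurent_poly (gs j)) = 1"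
        by (simp add: algebra_simps)
      then show ?thesis by blast
    qed
    with local show "[x = y] (mod laurent_poly g)"
      unfolding g_def laurent_poly_prod cong_iff_dvd_diff
      by (intro prod_dvd_if_complements_comaximal assms(1)) auto
  qed
  have E_zero: "[E i = 0] (mod laurent_poly (gs j))" if "i \<in> I" "j \<in> I" "j \<noteq> i" for i j
    unfolding cong_0_iff
    by (rule dvd_trans[OF dvd_prodI E_dvd]) (use that assms(1) in auto)
  have basis_gen: "integral_mod (gs j) f \<longleftrightarrow>
      (\<exists>k. [f = power_series_combination k (v j) (D j)] (mod laurent_poly (gs j)))" if "j \<in> I" for j f
    using represents_integral_basis_iff[OF monic degree fin inj, OF that that that that]
      basis[OF that] by simp
  have basis_indep: "k d = 0"
    if "j \<in> I" "[power_series_combination k (v j) (D j) = 0] (mod laurent_poly (gs j))" "d \<in> D j" for j k d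
    using represents_integral_basis_iff[OF monic degree fin inj, OF that(1) that(1) that(1) that(1)]
      basis[OF that(1)] that(2,3) by simp
  have combination_mod: "[power_series_combination k w (Sigma I D)
      = power_series_combination (\<lambda>d. k (j, d)) (v j) (D j)] (mod laurent_poly (gs j))"
    if j: "j \<in> I" for k j
  proof -
    let ?c = "\<lambda>i. power_series_combination (\<lambda>d. k (i, d)) (v i) (D i)"
    have "power_series_combination k w (Sigma I D) = (\<Sum>i\<in>I. E i * ?c i)"
      unfolding power_series_combination_def w_def sum_distrib_left
      by (subst sum.Sigma) (use assms(1) fin in \<open>auto intro!: sum.cong\<close>)
    also have "[(\<Sum>i\<in>I. E i * ?c i) = (\<Sum>i\<in>I. if i = j then ?c i else 0)] (mod laurent_poly (gs j))"
    proof (rule cong_sum)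
      fix i assume "i \<in> I"
      then show "[E i * ?c i = (if i = j then ?c i else 0)] (mod laurent_poly (gs j))"
        using cong_mult[OF E_one cong_refl, of i "?c i"] cong_mult[OF E_zero cong_refl, of i j "?c i"] j
        by auto
    qed
    also have "(\<Sum>i\<in>I. if i = j then ?c i else 0) = ?c j"
      using assms(1) j by simp
    finally show ?thesis .
  qed
  have indep: "k x = 0"
    if zero: "[power_series_combination k w (Sigma I D) = 0] (mod laurent_poly g)"
      and x_in: "x \<in> Sigma I D" for k x
  proof -
    obtain j d where x: "x = (j, d)" "j \<in> I" "d \<in> D j" using x_in by blast
    have "[power_series_combination (\<lambda>d. k (j, d)) (v j) (D j) = 0] (mod laurent_poly (gs j))"
      using cong_trans[OF cong_sym[OF combination_mod[OF x(2)]]] zero x(2) cong_g_iff by blast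
    from basis_indep[OF x(2) this x(3)] show ?thesis by (simp only: x(1))
  qed
  \<comment> \<open>Equal classes for distinct indices would be a relation with coefficients \<open>1\<close> and \<open>-1\<close>.\<close>
  have w_inj: "inj_on (\<lambda>x. residue_class g (w x)) (Sigma I D)"
  proof (rule inj_onI)
    fix x y assume x: "x \<in> Sigma I D" and y: "y \<in> Sigma I D"
      and eq: "residue_class g (w x) = residue_class g (w y)"
    let ?\<delta> = "\<lambda>x z. if z = x then 1 else 0 :: 'k fps"
    have fin': "finite (Sigma I D)" using assms(1) fin by blast
    have "power_series_combination (\<lambda>z. ?\<delta> x z - ?\<delta> y z) w (Sigma I D) = w x - w y"
    proof -
      have "power_series_combination (\<lambda>z. ?\<delta> x z - ?\<delta> y z) w (Sigma I D)
        = power_series_combination (?\<delta> x) w (Sigma I D) - power_series_combination (?\<delta> y) w (Sigma I D)"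
        unfolding power_series_combination_def sum_subtractf[symmetric]
        by (simp only: fps_to_fls_minus smult_diff_left)
      then show ?thesis
        by (simp only: power_series_combination_single[OF fin' x] power_series_combination_single[OF fin' y])
    qed
    then have "[power_series_combination (\<lambda>z. ?\<delta> x z - ?\<delta> y z) w (Sigma I D) = 0] (mod laurent_poly g)"
      using eq by (simp only: residue_class_eq_iff cong_iff_dvd_diff diff_zero)
    from indep[OF this x] show "x = y" by (simp split: if_splits)
  qed
  have gen: "integral_mod g f \<longleftrightarrow> (\<exists>k. [f = power_series_combination k w (Sigma I D)] (mod laurent_poly g))" for f
  proof -
    have "integral_mod g f \<longleftrightarrow>
      (\<forall>j\<in>I. \<exists>k. [f = power_series_combination k (v j) (D j)] (mod laurent_poly (gs j)))"
      unfolding g_def integral_mod_prod_iff[OF assms(1)] using basis_gen by simp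
    \<comment> \<open>The coefficients for the different factors are independent of each other.\<close>
    also have "\<dots> \<longleftrightarrow>
      (\<exists>k. \<forall>j\<in>I. [f = power_series_combination (\<lambda>d. k (j, d)) (v j) (D j)] (mod laurent_poly (gs j)))"
    proof
      assume "\<forall>j\<in>I. \<exists>k. [f = power_series_combination k (v j) (D j)] (mod laurent_poly (gs j))"
      then obtain k where "\<forall>j\<in>I. [f = power_series_combination (k j) (v j) (D j)] (mod laurent_poly (gs j))"
        by (elim bchoice[THEN exE])
      then show "\<exists>k. \<forall>j\<in>I. [f = power_series_combination (\<lambda>d. k (j, d)) (v j) (D j)] (mod laurent_poly (gs j))"
        by (intro exI[of _ "\<lambda>(j, d). k j d"]) simp
    qed blast
    also have "\<dots> \<longleftrightarrow> (\<exists>k. [f = power_series_combination k w (Sigma I D)] (mod laurent_poly g))"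
      unfolding cong_g_iff using combination_mod by (simp add: cong_def)
    finally show ?thesis .
  qed
  have "finite (Sigma I D)" using assms(1) fin by blast
  from represents_integral_basis_iff[OF g_monic g_degree this w_inj] gen indep
  show ?thesis unfolding g_def w_def by blast
qed

theorem proposition37:
  fixes g :: "'k::field_char_0 fps poly"
    and s :: nat
    and gs h a b :: "nat \<Rightarrow> 'k fps poly"
    and p :: "nat \<Rightarrow> nat \<Rightarrow> 'k fps poly"
    and e :: "nat \<Rightarrow> nat \<Rightarrow> int"
    and c :: "nat \<Rightarrow> nat"
    and \<B> \<B>' :: "nat \<Rightarrow> 'k fls poly set"
  assumes "squarefree g"
    and "Polynomial.lead_coeff g = 1"
    and "Polynomial.degree g \<ge> 1"
    and "g = (\<Prod>i\<in>{1..s}. gs i)"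
    and "\<And>i. i \<in> {1..s} \<Longrightarrow> irreducible (gs i)"
    and "\<And>i. i \<in> {1..s} \<Longrightarrow> Polynomial.lead_coeff (gs i) = 1"
    and "\<And>i d. i \<in> {1..s} \<Longrightarrow> d < Polynomial.degree (gs i) \<Longrightarrow>
           Polynomial.lead_coeff (p i d) = 1 \<and> Polynomial.degree (p i d) = d"
    and "\<And>i. i \<in> {1..s} \<Longrightarrow> p i 0 = 1 \<and> e i 0 = 0"
    and "\<And>i. i \<in> {1..s} \<Longrightarrow>
           \<B> i = {div_X_power (p i d) (e i d) | d. d < Polynomial.degree (gs i)}"
    and "\<And>i. i \<in> {1..s} \<Longrightarrow> represents_integral_basis (gs i) (\<B> i)"
    and "\<And>i. i \<in> {1..s} \<Longrightarrow> h i = (\<Prod>j\<in>{1..s} - {i}. gs j)"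
    and "\<And>i. i \<in> {1..s} \<Longrightarrow> a i * gs i + b i * h i = [:fps_X ^ c i:]"
    and "\<And>i. i \<in> {1..s} \<Longrightarrow>
           \<B>' i = {div_X_power (b i * h i * p i d) (int (c i) + e i d) | d.
                     d < Polynomial.degree (gs i)}"
  shows "represents_integral_basis g (\<Union>i\<in>{1..s}. \<B>' i)"
proof -
  note g_degree = assms(3) and g_prod = assms(4) and irred = assms(5) and monic = assms(6)
    and p = assms(7) and B = assms(9) and basis = assms(10) and h = assms(11) and bezout = assms(12) and B' = assms(13)
  define E where "E i = div_X_power (b i * h i) (int (c i))" for i
  define v where "v i d = div_X_power (p i d) (e i d)" for i d
  have X_powi: "fls_X powi n \<noteq> (0 :: 'k fls)" for n
    by simp
  \<comment> \<open>A monic constant is \<open>1\<close>, a unit.\<close>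
  have gs_degree: "Polynomial.degree (gs i) \<ge> 1" if i: "i \<in> {1..s}" for i
  proof (rule ccontr)
    assume "\<not> Polynomial.degree (gs i) \<ge> 1"
    then have "Polynomial.degree (gs i) = 0" by simp
    then obtain u where u: "gs i = [:u:]" by (rule degree_eq_zeroE)
    then have "gs i = 1"
      using monic[OF i] by (simp add: one_pCons)
    then show False using irred[OF i] by simp
  qed
  \<comment> \<open>Below the degree of the modulus, congruent polynomials are equal, and here degrees differ.\<close>
  have inj: "inj_on (\<lambda>d. residue_class (gs i) (v i d)) {..<Polynomial.degree (gs i)}" if i: "i \<in> {1..s}" for i
  proof (rule inj_onI)
    fix d d' assume d: "d \<in> {..<Polynomial.degree (gs i)}" "d' \<in> {..<Polynomial.degree (gs i)}"
      and eq: "residue_class (gs i) (v i d) = residue_class (gs i) (v i d')"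
    have deg: "Polynomial.degree (v i d) = d" if "d \<in> {..<Polynomial.degree (gs i)}" for d
      using p[OF i, of d] that X_powi by (simp add: v_def div_X_power_def degree_laurent_poly)
    have "v i d = v i d'"
      by (rule cong_small_degree_eq[OF eq[unfolded residue_class_eq_iff]])
        (simp_all only: degree_laurent_poly deg[OF d(1)] deg[OF d(2)] d[unfolded lessThan_iff])
    then show "d = d'" using deg[OF d(1)] deg[OF d(2)] by metis
  qed
  have B_image: "\<B> i = v i ` {..<Polynomial.degree (gs i)}" if "i \<in> {1..s}" for i
    using B[OF that] by (auto simp: v_def)
  have B'_image: "\<B>' i = (\<lambda>d. E i * v i d) ` {..<Polynomial.degree (gs i)}" if "i \<in> {1..s}" for i
  proof -
    have "fls_X powi (int (c i) + n) = (fls_X powi int (c i) * fls_X powi n :: 'k fls)" for n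
      by (rule power_int_add) simp
    then have "div_X_power (b i * h i * p i d) (int (c i) + e i d) = E i * v i d" for d
      by (simp only: E_def v_def div_X_power_def laurent_poly_hom inverse_mult_distrib
        mult_smult_left mult_smult_right smult_smult mult.commute)
    then show ?thesis using B'[OF that] by auto
  qed
  have E_one: "[E i = 1] (mod laurent_poly (gs i))" if i: "i \<in> {1..s}" for i
  proof -
    have "laurent_poly (a i * gs i + b i * h i) = [:fls_X powi int (c i):]"
      unfolding bezout[OF i] by (simp add: map_poly_pCons fps_to_fls_power)
    then have "Polynomial.smult (inverse (fls_X powi int (c i))) (laurent_poly (a i) * laurent_poly (gs i)) + E i = 1"
      using X_powi by (simp add: E_def div_X_power_def laurent_poly_hom flip: smult_add_right)
    then have "1 - E i = laurent_poly (gs i) * Polynomial.smult (inverse (fls_X powi int (c i))) (laurent_poly (a i))"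
      by (simp add: algebra_simps)
    then show ?thesis
      by (intro cong_sym[of 1]) (simp only: cong_iff_dvd_diff dvd_triv_left)
  qed
  have E_dvd: "(\<Prod>j\<in>{1..s} - {i}. laurent_poly (gs j)) dvd E i" if "i \<in> {1..s}" for i
    unfolding E_def div_X_power_def laurent_poly_hom h[OF that] laurent_poly_prod
    by (intro dvd_smult dvd_triv_right)
  have nonempty: "{1..s} \<noteq> {}"
  proof
    assume "{1..s} = {}"
    then have "g = 1" by (simp only: g_prod prod.empty)
    then show False using g_degree by simp
  qed
  have v_basis: "represents_integral_basis (gs i) (v i ` {..<Polynomial.degree (gs i)})"
    if "i \<in> {1..s}" for i
    using basis[OF that] unfolding B_image[OF that] .
  have "represents_integral_basis g
      ((\<lambda>(i, d). E i * v i d) ` (SIGMA i:{1..s}. {..<Polynomial.degree (gs i)}))"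
    unfolding g_prod
    by (rule represents_integral_basis_prod)
      (rule finite_atLeastAtMost finite_lessThan | fact nonempty monic gs_degree inj v_basis E_one E_dvd)+
  also have "(\<lambda>(i, d). E i * v i d) ` (SIGMA i:{1..s}. {..<Polynomial.degree (gs i)})
    = (\<Union>i\<in>{1..s}. \<B>' i)"
    using B'_image by force
  finally show ?thesis .
qed

end
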